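(* In the system described in the context, an optimal design $(c^*,l^* )$ for Problem 3 (and consequently for Problem 2 and thereby for Problem 1, all defined in the context) can be determined by the solution of the following nested optimality equations: $$\widehat V_T(\varphi)\equiv 0,$$ $$V_t(\pi)=\inf_{c_t\in\mathscr C_S}\Big[\tilde\rho_t\big(Q_t(c_t)\pi\big)+\widehat V_t\big(Q_t(c_t)\pi\big)\Big],\qquad t=1,\dots,T,$$ $$\widehat V_t(\varphi)=\min_{l_t\in\mathscr L}\Big[V_{t+1}\big(\widehat Q_t(l_t)\varphi\big)\Big],\qquad t=1,\dots,T-1.$$
   Context: System. $\mathcal X,\mathcal Z,\mathcal Y,\mathcal M$ are finite sets, $\mathcal M=\{1,\dots,|\mathcal M|\}$, and $T$ is a finite horizon. For sequences, $x^t=(x_1,\dots,x_t)$, and similarly for random variables and functions. $X_1,\dots,X_T$ is a first-order Markov source on $\mathcal X$ with known law of $X_1$ and known transition probabilities $P_{X_{t+1}|X_t}$. At each stage $t$ the encoder sends $Z_t=c_t(X_1,\dots,X_t)\in\mathcal Z$ through a discrete memoryless channel with output $Y_t\in\mathcal Y$ and $\Pr(y_t\mid x^t,z^t,y^{t-1})=\Pr(y_t\mid z_t)=P_t(y_t,z_t)$. The receiver has memory $M_t\in\mathcal M$, with $M_0=1$ and $M_t=l_t(Y_t,M_{t-1})$ for $t=1,\dots,T-1$, and produces the estimate $\widehat X_t=g_t(Y_t,M_{t-1})\in\mathcal X$ for $t=1,\dots,T$. Distortion functions $\rho_t:\mathcal X\times\mathcal X\to[0,\infty)$ are given. For a finite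 set $S$, $\mathcal P^S$ is the space of probability mass functions on $S$. $\mathscr L$ is the family of functions $\mathcal Y\times\mathcal M\to\mathcal M$, $\mathscr G$ the family of functions $\mathcal Y\times\mathcal M\to\mathcal X$, $\mathscr C_t$ the family of functions $\mathcal X^t\to\mathcal Z$, and $\mathscr C_S$ the family of functions $\mathcal X\times\mathcal P^{\mathcal M}\to\mathcal Z$. Problem 1. Choose $(c^*,g^*,l^* )$ minimizing $\mathcal J(c,g,l)=\mathbb E\{\sum_{t=1}^T\rho_t(X_t,\widehat X_t)\mid c,g,l\}$ over $c\in\mathscr C_1\times\dots\times\mathscr C_T$, $g\in\mathscr G^T$, $l\in\mathscr L^{T-1}$. Structured encoders and optimal decoders. Rules $c\in\mathscr C_S^T$ are used as $Z_t=c_t(X_t,P_{M_{t-1}})$, where $P_{M_t}(m)=\Pr(M_t=m\mid X^t,Z^t,c^t,l^t)$ is the encoder's belief about the receiver's memory contents; since $M_0=1$, $P_{M_0}$ is the point mass at $1$. For given $(c,l)$, $g^*(c,l)=(g_1^*,\dots,g_T^* )$ is an optimal decoder: $g_t^*(y,m)=\arg\min_{\hat x}\sum_{x\in\mathcal X}\rho_t(x,\hat x)\Pr(X_t=x\mid Y_t=y,M_{t-1}=m)$, which depends on the design only through $c^t,l^{t-1}$. Problem 2. Choose $(c^*,l^* )$ attaining the infimum of $\widetilde{\mathcal J}(c,l)=\mathcal J(c,g^*(c,l),l)$ over $c\in\mathscr C_S^T$, $l\in\mathscr L^{T-1}$. A solution $(c^*,l^* )$ of Problem 2 together with the decoder $g^*(c^*,l^*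 )$ gives a solution of Problem 1. Information states. $P_{Y_t,M_{t-1}}(y,m)=\Pr(Y_t=y,M_{t-1}=m\mid X^t,Z^t,c^t,l^{t-1})$ is the encoder's belief about the channel output and memory contents. $\Pi$ (resp. $\Phi$) is the space of probability measures on $\mathcal X\times\mathcal P^{\mathcal M}$ (resp. $\mathcal X\times\mathcal P^{\mathcal Y\times\mathcal M}$); $\pi_t\in\Pi$ is the joint law of $(X_t,P_{M_{t-1}})$ and $\varphi_t\in\Phi$ is the joint law of $(X_t,P_{Y_t,M_{t-1}})$. $Q_t(c_t)$ and $\widehat Q_t(l_t)$ are linear transformations, depending on $c_t$ and $l_t$ respectively, such that $\varphi_t=Q_t(c_t)\pi_t$ and $\pi_{t+1}=\widehat Q_t(l_t)\varphi_t$; $\tilde\rho_t(\cdot)$ is a deterministic function such that, for any choice of $c$ and $l$, $\mathbb E\{\rho_t(X_t,\widehat X_t)\mid c^t,g_t^*(c^t,l^{t-1}),l^{t-1}\}=\tilde\rho_t(\varphi_t)$. The existence of $Q_t,\widehat Q_t,\tilde\rho_t$ with these properties is taken as known. In the optimality equations, $V_t$ is a function on $\Pi$ and $\widehat V_t$ a function on $\Phi$. Problem 3. Consider the deterministic system $\varphi_t=Q_t(c_t)\pi_t$ ($t=1,\dots,T$), $\pi_{t+1}=\widehat Q_t(l_t)\varphi_t$ ($t=1,\dots,T-1$), with $c_t\in\mathscr C_S$, $l_t\in\mathscr L$ and known initial state $\pi_1$; in state $\varphi$ at stage $t$ it incurs cost $\tilde\rho_t(\varphi)$. Find $(c^*,l^*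 )$, $c^*=(c_1^*,\dots,c_T^* )$, $l^*=(l_1^*,\dots,l_{T-1}^* )$, attaining the infimum of the total cost $\sum_{t=1}^T\tilde\rho_t(\varphi_t)$ over $c\in\mathscr C_S^T$, $l\in\mathscr L^{T-1}$. *)

theory Defs
  imports "HOL-Probability.Probability"
begin

text \<open>
  The sets X, Z, Y, M are rendered by type variables of class \<open>finite\<close>; \<open>mem_init\<close> is the
  element written 1 of M. \<open>src_trans S t x\<close> is the law of \<open>X(t+1)\<close> given \<open>X(t) = x\<close>, and
  \<open>channel S t z\<close> is the law of \<open>Y(t)\<close> given \<open>Z(t) = z\<close>, i.e. \<open>pmf (channel S t z) y = P(t)(y,z)\<close>.
\<close>

record ('x, 'z, 'y, 'm) comm_data =
  horizon :: nat
  src_init :: "'x pmf"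
  src_trans :: "nat \<Rightarrow> 'x \<Rightarrow> 'x pmf"
  channel :: "nat \<Rightarrow> 'z \<Rightarrow> 'y pmf"
  distortion :: "nat \<Rightarrow> 'x \<Rightarrow> 'x \<Rightarrow> real"
  mem_init :: 'm

definition comm_system :: "('x, 'z, 'y, 'm) comm_data \<Rightarrow> bool" where
  "comm_system S \<longleftrightarrow> 1 \<le> horizon S \<and>
     (\<forall>t\<in>{1..horizon S}. \<forall>x xh. 0 \<le> distortion S t x xh)"

text \<open>
  Stages are numbered from 1. All design rules are sequences indexed by \<open>nat\<close>; only the entries
  at the stages that occur in the problem are ever used. Likewise a rule of type
  \<open>nat \<Rightarrow> 'x list \<Rightarrow> 'z\<close> is applied at stage \<open>t\<close> to lists of length \<open>t\<close> only.
\<close>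

type_synonym ('x, 'z) encoder = "nat \<Rightarrow> 'x list \<Rightarrow> 'z"
type_synonym ('x, 'z, 'm) senc = "'x \<times> 'm pmf \<Rightarrow> 'z"
type_synonym ('x, 'y, 'm) decoder = "nat \<Rightarrow> 'y \<times> 'm \<Rightarrow> 'x"
type_synonym ('y, 'm) mem_update = "'y \<times> 'm \<Rightarrow> 'm"

text \<open>A history of length \<open>t\<close> lists the triples \<open>(X(s), Z(s), Y(s))\<close> for \<open>s = 1, ..., t\<close>.\<close>

type_synonym ('x, 'z, 'y) history = "('x \<times> 'z \<times> 'y) list"

definition srcs :: "('x, 'z, 'y) history \<Rightarrow> 'x list" where
  "srcs h = map (\<lambda>(x, z, y). x) h"

definition ins :: "('x, 'z, 'y) history \<Rightarrow> 'z list" where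
  "ins h = map (\<lambda>(x, z, y). z) h"

definition outs :: "('x, 'z, 'y) history \<Rightarrow> 'y list" where
  "outs h = map (\<lambda>(x, z, y). y) h"

definition src_at :: "nat \<Rightarrow> ('x, 'z, 'y) history \<Rightarrow> 'x" where
  "src_at t h = srcs h ! (t - 1)"

definition out_at :: "nat \<Rightarrow> ('x, 'z, 'y) history \<Rightarrow> 'y" where
  "out_at t h = outs h ! (t - 1)"

primrec traj :: "('x, 'z, 'y, 'm) comm_data \<Rightarrow> ('x, 'z) encoder \<Rightarrow> nat \<Rightarrow> ('x, 'z, 'y) history pmf" where
  "traj S e 0 = return_pmf []"
| "traj S e (Suc t) =
     bind_pmf (traj S e t) (\<lambda>h.
     bind_pmf (if t = 0 then src_init S else src_trans S t (src_at t h)) (\<lambda>x.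
     let z = e (Suc t) (srcs h @ [x]) in
     map_pmf (\<lambda>y. h @ [(x, z, y)]) (channel S (Suc t) z)))"

primrec mem :: "('x, 'z, 'y, 'm) comm_data \<Rightarrow> (nat \<Rightarrow> ('y, 'm) mem_update) \<Rightarrow> nat \<Rightarrow> ('x, 'z, 'y) history \<Rightarrow> 'm" where
  "mem S l 0 h = mem_init S"
| "mem S l (Suc t) h = l (Suc t) (out_at (Suc t) h, mem S l t h)"

definition J :: "('x, 'z, 'y, 'm) comm_data \<Rightarrow> ('x, 'z) encoder \<Rightarrow> ('x, 'y, 'm) decoder \<Rightarrow>
    (nat \<Rightarrow> ('y, 'm) mem_update) \<Rightarrow> real" where
  "J S e g l = measure_pmf.expectation (traj S e (horizon S))
     (\<lambda>h. \<Sum>t = 1..horizon S. distortion S t (src_at t h) (g t (out_at t h, mem S l (t - 1) h)))"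

definition problem1_optimal :: "('x, 'z, 'y, 'm) comm_data \<Rightarrow> ('x, 'z) encoder \<Rightarrow> ('x, 'y, 'm) decoder \<Rightarrow>
    (nat \<Rightarrow> ('y, 'm) mem_update) \<Rightarrow> bool" where
  "problem1_optimal S e g l \<longleftrightarrow> (\<forall>e' g' l'. J S e g l \<le> J S e' g' l')"

text \<open>
  Conditional law of \<open>f\<close> given that the source and channel-input sequences are \<open>xs\<close> and \<open>zs\<close>.
  If that event has probability 0, \<open>cond_pmf\<close> is an unspecified pmf; such arguments are
  never met along a history of positive probability.
\<close>

definition given :: "('x, 'z, 'y) history pmf \<Rightarrow> (('x, 'z, 'y) history \<Rightarrow> 'a) \<Rightarrow> 'x list \<Rightarrow> 'z list \<Rightarrow> 'a pmf" where
  "given p f xs zs = map_pmf f (cond_pmf p {h. srcs h = xs \<and> ins h = zs})"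

definition mem_belief :: "('x, 'z, 'y, 'm) comm_data \<Rightarrow> ('x, 'z) encoder \<Rightarrow> (nat \<Rightarrow> ('y, 'm) mem_update) \<Rightarrow>
    nat \<Rightarrow> 'x list \<Rightarrow> 'z list \<Rightarrow> 'm pmf" where
  "mem_belief S e l t xs zs = given (traj S e t) (mem S l t) xs zs"

definition out_mem_belief :: "('x, 'z, 'y, 'm) comm_data \<Rightarrow> ('x, 'z) encoder \<Rightarrow> (nat \<Rightarrow> ('y, 'm) mem_update) \<Rightarrow>
    nat \<Rightarrow> 'x list \<Rightarrow> 'z list \<Rightarrow> ('y \<times> 'm) pmf" where
  "out_mem_belief S e l t xs zs =
     given (traj S e t) (\<lambda>h. (out_at t h, mem S l (t - 1) h)) xs zs"

definition inputs :: "('x, 'z) encoder \<Rightarrow> 'x list \<Rightarrow> 'z list" where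
  "inputs e xs = map (\<lambda>s. e s (take s xs)) [1..<Suc (length xs)]"

text \<open>
  A structured rule reads \<open>(X(t), P(M(t-1)))\<close>, and the belief \<open>P(M(t-1))\<close> depends on the rules used at
  stages before \<open>t\<close>. The encoder \<open>X^t \<Rightarrow> Z\<close> it induces is therefore built stage by stage:
  \<open>enc_upto S c l n\<close> is correct at the stages \<open>1, ..., n\<close> and arbitrary elsewhere.
\<close>

primrec enc_upto :: "('x, 'z, 'y, 'm) comm_data \<Rightarrow> (nat \<Rightarrow> ('x, 'z, 'm) senc) \<Rightarrow>
    (nat \<Rightarrow> ('y, 'm) mem_update) \<Rightarrow> nat \<Rightarrow> ('x, 'z) encoder" where
  "enc_upto S c l 0 = (\<lambda>_ _. undefined)"
| "enc_upto S c l (Suc t) = (enc_upto S c l t)(Suc t :=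
     (\<lambda>xs. c (Suc t) (last xs,
        mem_belief S (enc_upto S c l t) l t (butlast xs) (inputs (enc_upto S c l t) (butlast xs)))))"

definition struct_enc :: "('x, 'z, 'y, 'm) comm_data \<Rightarrow> (nat \<Rightarrow> ('x, 'z, 'm) senc) \<Rightarrow>
    (nat \<Rightarrow> ('y, 'm) mem_update) \<Rightarrow> ('x, 'z) encoder" where
  "struct_enc S c l t = enc_upto S c l t t"

definition opt_decoder :: "('x::finite, 'z, 'y, 'm) comm_data \<Rightarrow> (nat \<Rightarrow> ('x, 'z, 'm) senc) \<Rightarrow>
    (nat \<Rightarrow> ('y, 'm) mem_update) \<Rightarrow> ('x, 'y, 'm) decoder" where
  "opt_decoder S c l t = (\<lambda>(y, m).
     arg_min (\<lambda>xh. \<Sum>x\<in>UNIV. distortion S t x xh *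
       cond_prob (measure_pmf (traj S (struct_enc S c l) t))
         (\<lambda>h. src_at t h = x) (\<lambda>h. out_at t h = y \<and> mem S l (t - 1) h = m))
     (\<lambda>_. True))"

definition J2 :: "('x::finite, 'z, 'y, 'm) comm_data \<Rightarrow> (nat \<Rightarrow> ('x, 'z, 'm) senc) \<Rightarrow>
    (nat \<Rightarrow> ('y, 'm) mem_update) \<Rightarrow> real" where
  "J2 S c l = J S (struct_enc S c l) (opt_decoder S c l) l"

definition problem2_optimal :: "('x::finite, 'z, 'y, 'm) comm_data \<Rightarrow> (nat \<Rightarrow> ('x, 'z, 'm) senc) \<Rightarrow>
    (nat \<Rightarrow> ('y, 'm) mem_update) \<Rightarrow> bool" where
  "problem2_optimal S c l \<longleftrightarrow> (\<forall>c' l'. J2 S c l \<le> J2 S c' l')"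

text \<open>
  The space of pmfs on a finite set carries the \<open>\<sigma>\<close>-algebra generated by the maps \<open>p \<mapsto> p(A)\<close>,
  which is the Borel \<open>\<sigma>\<close>-algebra of the probability simplex.
\<close>

definition pmf_space :: "'a pmf measure" where
  "pmf_space = vimage_algebra UNIV measure_pmf (prob_algebra (count_space UNIV))"

definition info_space :: "('x \<times> 'a pmf) measure" where
  "info_space = count_space UNIV \<Otimes>\<^sub>M pmf_space"

definition Laws :: "('x \<times> 'a pmf) measure set" where
  "Laws = space (prob_algebra info_space)"

type_synonym ('x, 'm) pi_state = "('x \<times> 'm pmf) measure"
type_synonym ('x, 'y, 'm) phi_state = "('x \<times> ('y \<times> 'm) pmf) measure"

definition pi_law :: "('x, 'z, 'y, 'm) comm_data \<Rightarrow> (nat \<Rightarrow> ('x, 'z, 'm) senc) \<Rightarrow>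
    (nat \<Rightarrow> ('y, 'm) mem_update) \<Rightarrow> nat \<Rightarrow> ('x, 'm) pi_state" where
  "pi_law S c l t = distr (measure_pmf (traj S (struct_enc S c l) t)) info_space
     (\<lambda>h. (src_at t h,
           mem_belief S (struct_enc S c l) l (t - 1) (take (t - 1) (srcs h)) (take (t - 1) (ins h))))"

definition phi_law :: "('x, 'z, 'y, 'm) comm_data \<Rightarrow> (nat \<Rightarrow> ('x, 'z, 'm) senc) \<Rightarrow>
    (nat \<Rightarrow> ('y, 'm) mem_update) \<Rightarrow> nat \<Rightarrow> ('x, 'y, 'm) phi_state" where
  "phi_law S c l t = distr (measure_pmf (traj S (struct_enc S c l) t)) info_space
     (\<lambda>h. (src_at t h, out_mem_belief S (struct_enc S c l) l t (srcs h) (ins h)))"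

text \<open>
  A transformation of probability measures is linear if it respects mixtures, i.e. if it is the
  restriction of a linear map on the span of the probability measures.
\<close>

definition linear_transformation ::
    "(('x \<times> 'a pmf) measure \<Rightarrow> ('x \<times> 'b pmf) measure) \<Rightarrow> bool" where
  "linear_transformation F \<longleftrightarrow>
     (\<forall>\<mu>\<in>Laws. F \<mu> \<in> Laws) \<and>
     (\<forall>\<mu>\<in>Laws. \<forall>\<nu>\<in>Laws. \<forall>\<kappa>\<in>Laws. \<forall>a\<in>{0..1}.
        (\<forall>A\<in>sets info_space. measure \<kappa> A = a * measure \<mu> A + (1 - a) * measure \<nu> A) \<longrightarrow>
        (\<forall>B\<in>sets info_space.
           measure (F \<kappa>) B = a * measure (F \<mu>) B + (1 - a) * measure (F \<nu>) B))"

definition info_state_maps :: "('x::finite, 'z, 'y, 'm) comm_data \<Rightarrow>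
    (nat \<Rightarrow> ('x, 'z, 'm) senc \<Rightarrow> ('x, 'm) pi_state \<Rightarrow> ('x, 'y, 'm) phi_state) \<Rightarrow>
    (nat \<Rightarrow> ('y, 'm) mem_update \<Rightarrow> ('x, 'y, 'm) phi_state \<Rightarrow> ('x, 'm) pi_state) \<Rightarrow>
    (nat \<Rightarrow> ('x, 'y, 'm) phi_state \<Rightarrow> real) \<Rightarrow> bool" where
  "info_state_maps S Q Qh rt \<longleftrightarrow>
     (\<forall>t\<in>{1..horizon S}. \<forall>c. linear_transformation (Q t c)) \<and>
     (\<forall>t\<in>{1..<horizon S}. \<forall>l. linear_transformation (Qh t l)) \<and>
     (\<forall>c l. \<forall>t\<in>{1..horizon S}. phi_law S c l t = Q t (c t) (pi_law S c l t)) \<and>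
     (\<forall>c l. \<forall>t\<in>{1..<horizon S}. pi_law S c l (t + 1) = Qh t (l t) (phi_law S c l t)) \<and>
     (\<forall>c l. \<forall>t\<in>{1..horizon S}.
        measure_pmf.expectation (traj S (struct_enc S c l) t)
          (\<lambda>h. distortion S t (src_at t h) (opt_decoder S c l t (out_at t h, mem S l (t - 1) h)))
        = rt t (phi_law S c l t))"

text \<open>The initial state is the law of \<open>(X(1), P(M(0)))\<close>, where \<open>P(M(0))\<close> is a point mass.\<close>

definition pi_init :: "('x, 'z, 'y, 'm) comm_data \<Rightarrow> ('x, 'm) pi_state" where
  "pi_init S = distr (measure_pmf (src_init S)) info_space (\<lambda>x. (x, return_pmf (mem_init S)))"

text \<open>\<open>det_state S Q Qh c l n\<close> is the state \<open>\<pi>\<close> of the deterministic system at stage \<open>n + 1\<close>.\<close>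

primrec det_state :: "('x, 'z, 'y, 'm) comm_data \<Rightarrow>
    (nat \<Rightarrow> ('x, 'z, 'm) senc \<Rightarrow> ('x, 'm) pi_state \<Rightarrow> ('x, 'y, 'm) phi_state) \<Rightarrow>
    (nat \<Rightarrow> ('y, 'm) mem_update \<Rightarrow> ('x, 'y, 'm) phi_state \<Rightarrow> ('x, 'm) pi_state) \<Rightarrow>
    (nat \<Rightarrow> ('x, 'z, 'm) senc) \<Rightarrow> (nat \<Rightarrow> ('y, 'm) mem_update) \<Rightarrow> nat \<Rightarrow> ('x, 'm) pi_state" where
  "det_state S Q Qh c l 0 = pi_init S"
| "det_state S Q Qh c l (Suc n) =
     Qh (Suc n) (l (Suc n)) (Q (Suc n) (c (Suc n)) (det_state S Q Qh c l n))"

definition det_pi :: "('x, 'z, 'y, 'm) comm_data \<Rightarrow>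
    (nat \<Rightarrow> ('x, 'z, 'm) senc \<Rightarrow> ('x, 'm) pi_state \<Rightarrow> ('x, 'y, 'm) phi_state) \<Rightarrow>
    (nat \<Rightarrow> ('y, 'm) mem_update \<Rightarrow> ('x, 'y, 'm) phi_state \<Rightarrow> ('x, 'm) pi_state) \<Rightarrow>
    (nat \<Rightarrow> ('x, 'z, 'm) senc) \<Rightarrow> (nat \<Rightarrow> ('y, 'm) mem_update) \<Rightarrow> nat \<Rightarrow> ('x, 'm) pi_state" where
  "det_pi S Q Qh c l t = det_state S Q Qh c l (t - 1)"

definition det_phi :: "('x, 'z, 'y, 'm) comm_data \<Rightarrow>
    (nat \<Rightarrow> ('x, 'z, 'm) senc \<Rightarrow> ('x, 'm) pi_state \<Rightarrow> ('x, 'y, 'm) phi_state) \<Rightarrow>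
    (nat \<Rightarrow> ('y, 'm) mem_update \<Rightarrow> ('x, 'y, 'm) phi_state \<Rightarrow> ('x, 'm) pi_state) \<Rightarrow>
    (nat \<Rightarrow> ('x, 'z, 'm) senc) \<Rightarrow> (nat \<Rightarrow> ('y, 'm) mem_update) \<Rightarrow> nat \<Rightarrow> ('x, 'y, 'm) phi_state" where
  "det_phi S Q Qh c l t = Q t (c t) (det_pi S Q Qh c l t)"

definition J3 :: "('x, 'z, 'y, 'm) comm_data \<Rightarrow>
    (nat \<Rightarrow> ('x, 'z, 'm) senc \<Rightarrow> ('x, 'm) pi_state \<Rightarrow> ('x, 'y, 'm) phi_state) \<Rightarrow>
    (nat \<Rightarrow> ('y, 'm) mem_update \<Rightarrow> ('x, 'y, 'm) phi_state \<Rightarrow> ('x, 'm) pi_state) \<Rightarrow>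
    (nat \<Rightarrow> ('x, 'y, 'm) phi_state \<Rightarrow> real) \<Rightarrow>
    (nat \<Rightarrow> ('x, 'z, 'm) senc) \<Rightarrow> (nat \<Rightarrow> ('y, 'm) mem_update) \<Rightarrow> real" where
  "J3 S Q Qh rt c l = (\<Sum>t = 1..horizon S. rt t (det_phi S Q Qh c l t))"

definition problem3_optimal :: "('x, 'z, 'y, 'm) comm_data \<Rightarrow>
    (nat \<Rightarrow> ('x, 'z, 'm) senc \<Rightarrow> ('x, 'm) pi_state \<Rightarrow> ('x, 'y, 'm) phi_state) \<Rightarrow>
    (nat \<Rightarrow> ('y, 'm) mem_update \<Rightarrow> ('x, 'y, 'm) phi_state \<Rightarrow> ('x, 'm) pi_state) \<Rightarrow>
    (nat \<Rightarrow> ('x, 'y, 'm) phi_state \<Rightarrow> real) \<Rightarrow>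
    (nat \<Rightarrow> ('x, 'z, 'm) senc) \<Rightarrow> (nat \<Rightarrow> ('y, 'm) mem_update) \<Rightarrow> bool" where
  "problem3_optimal S Q Qh rt c l \<longleftrightarrow> (\<forall>c' l'. J3 S Q Qh rt c l \<le> J3 S Q Qh rt c' l')"

text \<open>
  The value functions are extended-real valued: \<open>rt\<close> is constrained only at the laws that
  a design generates, so at other elements of the space the infimum may be \<open>-\<infinity>\<close>.
\<close>

definition optimality_equations :: "('x, 'z, 'y::finite, 'm::finite) comm_data \<Rightarrow>
    (nat \<Rightarrow> ('x, 'z, 'm) senc \<Rightarrow> ('x, 'm) pi_state \<Rightarrow> ('x, 'y, 'm) phi_state) \<Rightarrow>
    (nat \<Rightarrow> ('y, 'm) mem_update \<Rightarrow> ('x, 'y, 'm) phi_state \<Rightarrow> ('x, 'm) pi_state) \<Rightarrow>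
    (nat \<Rightarrow> ('x, 'y, 'm) phi_state \<Rightarrow> real) \<Rightarrow>
    (nat \<Rightarrow> ('x, 'm) pi_state \<Rightarrow> ereal) \<Rightarrow> (nat \<Rightarrow> ('x, 'y, 'm) phi_state \<Rightarrow> ereal) \<Rightarrow> bool" where
  "optimality_equations S Q Qh rt V Vh \<longleftrightarrow>
     (\<forall>\<phi>\<in>Laws. Vh (horizon S) \<phi> = 0) \<and>
     (\<forall>t\<in>{1..horizon S}. \<forall>\<pi>\<in>Laws.
        V t \<pi> = (INF c. ereal (rt t (Q t c \<pi>)) + Vh t (Q t c \<pi>))) \<and>
     (\<forall>t\<in>{1..<horizon S}. \<forall>\<phi>\<in>Laws. Vh t \<phi> = (MIN l. V (t + 1) (Qh t l \<phi>)))"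

text \<open>
  \<open>(c, l)\<close> is read off from \<open>(V, Vh)\<close> if, along the state trajectory that it generates from the initial
  state, each \<open>c t\<close> attains the infimum and each \<open>l t\<close> attains the minimum.
\<close>

definition determined_by :: "('x, 'z, 'y, 'm) comm_data \<Rightarrow>
    (nat \<Rightarrow> ('x, 'z, 'm) senc \<Rightarrow> ('x, 'm) pi_state \<Rightarrow> ('x, 'y, 'm) phi_state) \<Rightarrow>
    (nat \<Rightarrow> ('y, 'm) mem_update \<Rightarrow> ('x, 'y, 'm) phi_state \<Rightarrow> ('x, 'm) pi_state) \<Rightarrow>
    (nat \<Rightarrow> ('x, 'y, 'm) phi_state \<Rightarrow> real) \<Rightarrow>
    (nat \<Rightarrow> ('x, 'm) pi_state \<Rightarrow> ereal) \<Rightarrow> (nat \<Rightarrow> ('x, 'y, 'm) phi_state \<Rightarrow> ereal) \<Rightarrow>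
    (nat \<Rightarrow> ('x, 'z, 'm) senc) \<Rightarrow> (nat \<Rightarrow> ('y, 'm) mem_update) \<Rightarrow> bool" where
  "determined_by S Q Qh rt V Vh c l \<longleftrightarrow>
     (\<forall>t\<in>{1..horizon S}.
        ereal (rt t (Q t (c t) (det_pi S Q Qh c l t))) + Vh t (Q t (c t) (det_pi S Q Qh c l t))
        = V t (det_pi S Q Qh c l t)) \<and>
     (\<forall>t\<in>{1..<horizon S}.
        V (t + 1) (Qh t (l t) (det_phi S Q Qh c l t)) = Vh t (det_phi S Q Qh c l t))"

end

theory Submission
  imports Defs
begin

text \<open>
  Along the laws that designs generate, the deterministic system reproduces \<open>pi_law\<close> and \<open>phi_law\<close>,
  so the cost of Problem 3 is that of Problem 2. At a fixed stage only finitely many laws of the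
  history exist, since \<open>X\<close> and \<open>Z\<close> are finite; hence the infimum over the infinite set of structured
  rules is attained at every reachable state, and the usual verification argument of dynamic
  programming applies.

  For Problem 1, fix the decoder and the memory update. The pair of source state and belief about the
  memory is then a Markov decision process with action \<open>Z(t)\<close>, because the next belief is a function of
  the current belief and \<open>Z(t)\<close>, and the expected distortion is a function of state, belief and
  action. So some structured encoder is at least as good as every encoder, and passing to its optimal
  decoder does not increase the cost.
\<close>

section \<open>Expectations over finite supports and attained infima\<close>

lemma expectation_bind_finite:
  fixes h :: "'b \<Rightarrow> real"
  assumes "finite (set_pmf p)" and "\<And>x. x \<in> set_pmf p \<Longrightarrow> finite (set_pmf (f x))"
  shows "measure_pmf.expectation (bind_pmf p f) h =
    measure_pmf.expectation p (\<lambda>x. measure_pmf.expectation (f x) h)"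
  using assms
  by (subst pmf_expectation_bind[of "set_pmf p"]) (simp_all add: integral_measure_pmf[of "set_pmf p"])

lemma expectation_mono_finite:
  fixes f g :: "'a \<Rightarrow> real"
  assumes "finite (set_pmf p)" and "\<And>x. x \<in> set_pmf p \<Longrightarrow> f x \<le> g x"
  shows "measure_pmf.expectation p f \<le> measure_pmf.expectation p g"
  using assms by (intro integral_mono_AE integrable_measure_pmf_finite) (auto simp: AE_measure_pmf_iff)

lemma expectation_cong_pmf:
  fixes f g :: "'a \<Rightarrow> real"
  assumes "\<And>x. x \<in> set_pmf p \<Longrightarrow> f x = g x"
  shows "measure_pmf.expectation p f = measure_pmf.expectation p g"
  using assms by (intro integral_cong_AE) (auto simp: AE_measure_pmf_iff)

lemma INF_attained_finite_range:
  fixes f :: "'a \<Rightarrow> ereal"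
  assumes "finite (range f)"
  shows "\<exists>a. f a = (INF x. f x)"
  using Min_in[OF assms] Min_Inf[OF assms] by (metis UNIV_not_empty image_iff image_is_empty)

section \<open>Trajectories\<close>

lemma srcs_simps [simp]: "srcs [] = []" "srcs (h @ h') = srcs h @ srcs h'"
  "srcs [(x, z, y)] = [x]" "length (srcs h) = length h" "srcs (take n h) = take n (srcs h)"
  by (simp_all add: srcs_def take_map)

lemma ins_simps [simp]: "ins [] = []" "ins (h @ h') = ins h @ ins h'"
  "ins [(x, z, y)] = [z]" "length (ins h) = length h" "ins (take n h) = take n (ins h)"
  by (simp_all add: ins_def take_map)

lemma outs_simps [simp]: "outs (h @ h') = outs h @ outs h'"
  "outs [(x, z, y)] = [y]" "length (outs h) = length h" "outs (take n h) = take n (outs h)"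
  by (simp_all add: outs_def take_map)

lemma src_at_snoc [simp]: "src_at (Suc (length h)) (h @ [(x, z, y)]) = x"
  and out_at_snoc [simp]: "out_at (Suc (length h)) (h @ [(x, z, y)]) = y"
  by (simp_all add: src_at_def out_at_def nth_append)

lemma src_at_take: "1 \<le> t \<Longrightarrow> t \<le> n \<Longrightarrow> src_at t (take n h) = src_at t h"
  and out_at_take: "1 \<le> t \<Longrightarrow> t \<le> n \<Longrightarrow> out_at t (take n h) = out_at t h"
  by (simp_all add: src_at_def out_at_def)

lemma mem_take: "t \<le> n \<Longrightarrow> mem S l t (take n h) = mem S l t h"
  by (induction t) (simp_all add: out_at_take)

lemma mem_append: "t \<le> length h \<Longrightarrow> mem S l t (h @ h') = mem S l t h"
  using mem_take[of t "length h" S l "h @ h'"] by simp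

text \<open>Treats the initial law and the transitions uniformly and reads only the source sequence,
  so that it can be part of a continuation depending on \<open>srcs\<close>, \<open>ins\<close> and
  the memory.\<close>

definition src_law :: "('x, 'z, 'y, 'm) comm_data \<Rightarrow> nat \<Rightarrow> 'x list \<Rightarrow> 'x pmf" where
  "src_law S t xs = (if t = 0 then src_init S else src_trans S t (xs ! (t - 1)))"

lemma traj_Suc:
  "traj S e (Suc t) = bind_pmf (traj S e t) (\<lambda>h. bind_pmf (src_law S t (srcs h)) (\<lambda>x.
     map_pmf (\<lambda>y. h @ [(x, e (Suc t) (srcs h @ [x]), y)]) (channel S (Suc t) (e (Suc t) (srcs h @ [x])))))"
  by (simp add: src_law_def src_at_def Let_def cong: if_cong)

declare traj.simps(2) [simp del]

lemma length_traj: "h \<in> set_pmf (traj S e t) \<Longrightarrow> length h = t"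
  by (induction t arbitrary: h) (auto simp: traj_Suc)

lemma finite_traj [simp]:
  fixes S :: "('x::finite, 'z, 'y::finite, 'm) comm_data"
  shows "finite (set_pmf (traj S e t))"
  by (induction t) (auto simp: traj_Suc)

lemma traj_cong:
  assumes "\<And>s xs. 1 \<le> s \<Longrightarrow> s \<le> t \<Longrightarrow> length xs = s \<Longrightarrow> e s xs = e' s xs"
  shows "traj S e t = traj S e' t"
  using assms
proof (induction t)
  case (Suc t)
  then have "traj S e t = traj S e' t" by simp
  moreover have "e (Suc t) (srcs h @ [x]) = e' (Suc t) (srcs h @ [x])"
    if "h \<in> set_pmf (traj S e' t)" for h x
    using Suc.prems[of "Suc t" "srcs h @ [x]"] length_traj[OF that] by simp
  ultimately show ?case by (auto simp: traj_Suc intro!: bind_pmf_cong)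
qed simp

text \<open>An encoder is an infinite object, but the law up to stage \<open>t\<close> reads only
  finitely many of its entries, each from a finite alphabet. This replaces compactness when infima
  over structured rules are attained.\<close>

lemma finite_range_traj:
  fixes S :: "('x::finite, 'z::finite, 'y, 'm) comm_data"
  shows "finite (range (\<lambda>e. traj S e t))"
proof -
  \<comment> \<open>\<open>K\<close> contains every argument that \<open>traj_cong\<close> compares.
    Off \<open>K\<close> the restricted rule is \<open>undefined\<close>, which the law never
    sees.\<close>
  define K :: "(nat \<times> 'x list) set" where "K = {1..t} \<times> {xs. set xs \<subseteq> UNIV \<and> length xs \<le> t}"
  have "finite K" unfolding K_def by (intro finite_cartesian_product finite_lists_length_le) auto
  then have fin: "finite (K \<rightarrow>\<^sub>E (UNIV :: 'z set))" by (intro finite_PiE) auto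
  have "traj S e t = traj S (curry (restrict (case_prod e) K)) t" for e
    by (rule traj_cong) (simp add: K_def)
  then have "range (\<lambda>e. traj S e t) \<subseteq> (\<lambda>f. traj S (curry f) t) ` (K \<rightarrow>\<^sub>E UNIV)"
    by (auto simp: image_iff intro!: bexI[of _ "restrict (case_prod _) K"])
  with fin show ?thesis by (meson finite_imageI finite_subset)
qed

lemma map_take_traj:
  assumes "t \<le> n"
  shows "map_pmf (take t) (traj S e n) = traj S e t"
  using assms
proof (induction rule: dec_induct)
  case base
  have "map_pmf (take t) (traj S e t) = map_pmf (\<lambda>h. h) (traj S e t)"
    by (rule map_pmf_cong) (auto dest: length_traj)
  then show ?case by simp
next
  case (step n)
  have "map_pmf (take t) (traj S e (Suc n)) = bind_pmf (traj S e n) (\<lambda>h. return_pmf (take t h))"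
    unfolding traj_Suc map_bind_pmf
  proof (rule bind_pmf_cong)
    fix h assume "h \<in> set_pmf (traj S e n)"
    \<comment> \<open>Since \<open>t \<le> n\<close>, \<open>take t\<close> erases the triple
      appended last, and the vacuous draws that produced it disappear.\<close>
    then show "bind_pmf (src_law S n (srcs h)) (\<lambda>x. map_pmf (take t) (map_pmf
      (\<lambda>y. h @ [(x, e (Suc n) (srcs h @ [x]), y)]) (channel S (Suc n) (e (Suc n) (srcs h @ [x])))))
      = return_pmf (take t h)"
      using step.hyps by (simp add: map_pmf_comp length_traj)
  qed simp
  then show ?case using step.IH by (simp add: map_pmf_def)
qed

lemma expectation_traj_take:
  fixes f :: "_ \<Rightarrow> real"
  assumes "t \<le> n" and "\<And>h. f (take t h) = f h"
  shows "measure_pmf.expectation (traj S e n) f = measure_pmf.expectation (traj S e t) f"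
  unfolding map_take_traj[OF assms(1), symmetric] by (simp add: assms(2))

lemma inputs_snoc: "inputs e (xs @ [x]) = inputs e xs @ [e (Suc (length xs)) (xs @ [x])]"
  by (auto simp: inputs_def)

lemma ins_traj: "h \<in> set_pmf (traj S e t) \<Longrightarrow> ins h = inputs e (srcs h)"
proof (induction t arbitrary: h)
  case 0
  then show ?case by (simp add: inputs_def)
next
  case (Suc t)
  then show ?case by (auto simp: traj_Suc inputs_snoc length_traj)
qed

lemma inputs_cong:
  assumes "\<And>s. 1 \<le> s \<Longrightarrow> s \<le> length xs \<Longrightarrow> e s (take s xs) = e' s (take s xs)"
  shows "inputs e xs = inputs e' xs"
  using assms by (auto simp: inputs_def)

lemma enc_upto_eq_struct_enc: "s \<le> n \<Longrightarrow> enc_upto S c l n s = struct_enc S c l s"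
  by (induction n rule: nat_induct) (auto simp: struct_enc_def le_Suc_eq)

text \<open>Turns the stagewise construction into a recursion of the structured encoder in itself:
  the belief after stage \<open>t\<close> reads only rules up to \<open>t\<close>, where
  \<open>enc_upto\<close> already has its final values.\<close>

lemma struct_enc_snoc:
  assumes "length xs = t"
  shows "struct_enc S c l (Suc t) (xs @ [x]) =
    c (Suc t) (x, mem_belief S (struct_enc S c l) l t xs (inputs (struct_enc S c l) xs))"
proof -
  have "traj S (enc_upto S c l t) t = traj S (struct_enc S c l) t"
    by (rule traj_cong) (simp add: enc_upto_eq_struct_enc)
  moreover have "inputs (enc_upto S c l t) xs = inputs (struct_enc S c l) xs"
    using assms by (intro inputs_cong) (simp add: enc_upto_eq_struct_enc)
  ultimately show ?thesis by (simp add: struct_enc_def[of _ _ _ "Suc t"] mem_belief_def)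
qed

section \<open>Stagewise decomposition of the cost\<close>

definition stage_cost :: "('x, 'z, 'y, 'm) comm_data \<Rightarrow> ('x, 'z) encoder \<Rightarrow> ('x, 'y, 'm) decoder \<Rightarrow>
    (nat \<Rightarrow> ('y, 'm) mem_update) \<Rightarrow> nat \<Rightarrow> real" where
  "stage_cost S e g l t = measure_pmf.expectation (traj S e t)
     (\<lambda>h. distortion S t (src_at t h) (g t (out_at t h, mem S l (t - 1) h)))"

lemma J_eq_sum_stage_cost:
  fixes S :: "('x::finite, 'z, 'y::finite, 'm) comm_data"
  shows "J S e g l = (\<Sum>t = 1..horizon S. stage_cost S e g l t)"
proof -
  have "J S e g l = (\<Sum>t = 1..horizon S. measure_pmf.expectation (traj S e (horizon S))
     (\<lambda>h. distortion S t (src_at t h) (g t (out_at t h, mem S l (t - 1) h))))"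
    unfolding J_def by (intro Bochner_Integration.integral_sum integrable_measure_pmf_finite) simp
  also have "\<dots> = (\<Sum>t = 1..horizon S. stage_cost S e g l t)"
    unfolding stage_cost_def
    by (intro sum.cong expectation_traj_take) (auto simp: src_at_take out_at_take mem_take)
  finally show ?thesis .
qed

section \<open>The deterministic system\<close>

lemma measurable_into_info_space: "f \<in> measurable (measure_pmf p) info_space"
  by (simp add: info_space_def pmf_space_def space_pair_measure)

lemma pi_init_in_Laws: "pi_init S \<in> Laws"
  unfolding pi_init_def Laws_def space_prob_algebra
  by (auto intro: measure_pmf.prob_space_distr measurable_into_info_space)

lemma pi_law_1:
  fixes S :: "('x, 'z, 'y, 'm) comm_data"
  shows "pi_law S c l 1 = pi_init S"
proof -
  \<comment> \<open>The empty history has positive probability, so \<open>cond_pmf\<close> is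
    specified here, and its singleton support determines it.\<close>
  have cond: "cond_pmf (return_pmf []) {h. srcs h = [] \<and> ins h = []} = return_pmf ([] :: ('x, 'z, 'y) history)"
  proof -
    have "set_pmf (cond_pmf (return_pmf []) {h. srcs h = [] \<and> ins h = []}) = {[] :: ('x, 'z, 'y) history}"
      by (subst set_cond_pmf) auto
    then show ?thesis by (simp add: set_pmf_subset_singleton[symmetric])
  qed
  have mem_0: "mem S l 0 = (\<lambda>_. mem_init S)" by auto
  let ?f = "\<lambda>h. (src_at 1 h, return_pmf (mem_init S))"
  have "pi_law S c l 1 = distr (measure_pmf (traj S (struct_enc S c l) 1)) info_space ?f"
    unfolding pi_law_def by (simp add: mem_belief_def given_def cond mem_0 del: mem.simps)
  \<comment> \<open>With a constant belief the state depends on the history only through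
    \<open>X(1)\<close>; factoring through \<open>src_at 1\<close> removes the channel draw.\<close>
  also have "\<dots> = distr (distr (measure_pmf (traj S (struct_enc S c l) 1)) (count_space UNIV) (src_at 1))
      info_space (\<lambda>x. (x, return_pmf (mem_init S)))"
    by (subst distr_distr)
      (simp_all add: info_space_def pmf_space_def space_pair_measure comp_def)
  also have "distr (measure_pmf (traj S (struct_enc S c l) 1)) (count_space UNIV) (src_at 1) =
      measure_pmf (map_pmf (src_at 1) (traj S (struct_enc S c l) 1))"
    by (simp add: map_pmf_rep_eq)
  also have "map_pmf (src_at 1) (traj S (struct_enc S c l) 1) = src_init S"
    by (simp add: traj_Suc bind_return_pmf map_bind_pmf map_pmf_comp src_law_def
        src_at_def bind_return_pmf')
  finally show ?thesis by (simp add: pi_init_def)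
qed

lemma det_state_cong:
  assumes "\<And>s. 1 \<le> s \<Longrightarrow> s \<le> n \<Longrightarrow> c s = c' s \<and> l s = l' s"
  shows "det_state S Q Qh c l n = det_state S Q Qh c' l' n"
  using assms by (induction n) simp_all

lemma det_pi_cong:
  assumes "\<And>s. 1 \<le> s \<Longrightarrow> s < t \<Longrightarrow> c s = c' s \<and> l s = l' s"
  shows "det_pi S Q Qh c l t = det_pi S Q Qh c' l' t"
  unfolding det_pi_def using assms by (intro det_state_cong) auto

lemma det_pi_1 [simp]: "det_pi S Q Qh c l (Suc 0) = pi_init S"
  by (simp add: det_pi_def)

lemma det_pi_Suc: "1 \<le> t \<Longrightarrow> det_pi S Q Qh c l (Suc t) = Qh t (l t) (det_phi S Q Qh c l t)"
  by (cases t) (simp_all add: det_pi_def det_phi_def)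

context
  fixes S :: "('x::finite, 'z::finite, 'y::finite, 'm::finite) comm_data"
    and Q :: "nat \<Rightarrow> ('x, 'z, 'm) senc \<Rightarrow> ('x, 'm) pi_state \<Rightarrow> ('x, 'y, 'm) phi_state"
    and Qh :: "nat \<Rightarrow> ('y, 'm) mem_update \<Rightarrow> ('x, 'y, 'm) phi_state \<Rightarrow> ('x, 'm) pi_state"
    and rt :: "nat \<Rightarrow> ('x, 'y, 'm) phi_state \<Rightarrow> real"
  assumes maps: "info_state_maps S Q Qh rt"
begin

lemma Q_in_Laws: "t \<in> {1..horizon S} \<Longrightarrow> \<pi> \<in> Laws \<Longrightarrow> Q t c \<pi> \<in> Laws"
  and Qh_in_Laws: "t \<in> {1..<horizon S} \<Longrightarrow> \<phi> \<in> Laws \<Longrightarrow> Qh t l \<phi> \<in> Laws"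
  using maps unfolding info_state_maps_def linear_transformation_def by blast+

lemma det_pi_eq_pi_law:
  assumes "1 \<le> t" "t \<le> horizon S"
  shows "det_pi S Q Qh c l t = pi_law S c l t"
  using assms
proof (induction rule: dec_induct)
  case base
  show ?case using pi_law_1[of S c l] by simp
next
  case (step t)
  then show ?case using maps unfolding info_state_maps_def
    by (simp add: det_pi_Suc det_phi_def)
qed

lemma det_phi_eq_phi_law:
  assumes "1 \<le> t" "t \<le> horizon S"
  shows "det_phi S Q Qh c l t = phi_law S c l t"
  using maps assms unfolding info_state_maps_def by (simp add: det_phi_def det_pi_eq_pi_law)

lemma det_pi_in_Laws:
  assumes "1 \<le> t" "t \<le> horizon S"
  shows "det_pi S Q Qh c l t \<in> Laws"
  using assms
proof (induction rule: dec_induct)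
  case base
  show ?case by (simp add: pi_init_in_Laws)
next
  case (step t)
  then show ?case by (simp add: det_pi_Suc det_phi_def Q_in_Laws Qh_in_Laws)
qed

lemma det_phi_in_Laws: "1 \<le> t \<Longrightarrow> t \<le> horizon S \<Longrightarrow> det_phi S Q Qh c l t \<in> Laws"
  by (simp add: det_phi_def Q_in_Laws det_pi_in_Laws)

lemma J2_eq_J3: "J2 S c l = J3 S Q Qh rt c l"
  unfolding J2_def J3_def J_eq_sum_stage_cost
proof (rule sum.cong)
  fix t assume t: "t \<in> {1..horizon S}"
  then show "stage_cost S (struct_enc S c l) (opt_decoder S c l) l t = rt t (det_phi S Q Qh c l t)"
    using maps by (simp add: info_state_maps_def stage_cost_def det_phi_eq_phi_law)
qed simp

text \<open>\<open>phi_law S c l t\<close> depends on \<open>c\<close> only through the law of the history up to stage \<open>t\<close>.\<close>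

lemma finite_range_Q_det_pi:
  assumes "1 \<le> t" "t \<le> horizon S"
  shows "finite (range (\<lambda>c'. Q t c' (det_pi S Q Qh c l t)))"
proof -
  have phi: "Q t c' (det_pi S Q Qh c l t) = phi_law S (c(t := c')) l t" for c'
  proof -
    have "det_pi S Q Qh c l t = det_pi S Q Qh (c(t := c')) l t" by (rule det_pi_cong) simp
    then show ?thesis
      using det_phi_eq_phi_law[OF assms, of "c(t := c')" l] by (simp add: det_phi_def)
  qed
  \<comment> \<open>\<open>?F\<close> rebuilds the state from the law of the history alone, so
    finitely many laws give finitely many states.\<close>
  let ?F = "\<lambda>p. distr (measure_pmf p) info_space
     (\<lambda>h. (src_at t h, given p (\<lambda>h. (out_at t h, mem S l (t - 1) h)) (srcs h) (ins h)))"
  have "phi_law S c' l t \<in> ?F ` range (\<lambda>e. traj S e t)" for c'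
    unfolding phi_law_def out_mem_belief_def by blast
  then have "range (\<lambda>c'. phi_law S (c(t := c')) l t) \<subseteq> ?F ` range (\<lambda>e. traj S e t)"
    by blast
  then show ?thesis unfolding phi by (rule finite_subset) (intro finite_imageI finite_range_traj)
qed

lemma optimality_equations_solvable: "\<exists>V Vh. optimality_equations S Q Qh rt V Vh"
proof -
  \<comment> \<open>\<open>W k\<close> is \<open>Vh\<close> with \<open>k\<close> stages remaining.
    Substituting the equation for \<open>V\<close> into that for \<open>Vh\<close> leaves one
    backward recursion, from which \<open>V\<close> is recovered. Subtraction inside
    \<open>W\<close> truncates only beyond \<open>horizon S\<close> remaining stages.\<close>
  define W where "W = rec_nat (\<lambda>\<phi>. 0 :: ereal) (\<lambda>k w \<phi>. MIN l. INF c.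
    ereal (rt (horizon S - k) (Q (horizon S - k) c (Qh (horizon S - Suc k) l \<phi>)))
      + w (Q (horizon S - k) c (Qh (horizon S - Suc k) l \<phi>)))"
  define Vh where "Vh t = W (horizon S - t)" for t
  define V where "V t \<pi> = (INF c. ereal (rt t (Q t c \<pi>)) + Vh t (Q t c \<pi>))" for t \<pi>
  have "Vh t \<phi> = (MIN l. V (t + 1) (Qh t l \<phi>))" if "t \<in> {1..<horizon S}" for t \<phi>
  proof -
    from that have "horizon S - t = Suc (horizon S - Suc t)" by auto
    then have "Vh t = W (Suc (horizon S - Suc t))" by (simp add: Vh_def)
    with that show ?thesis by (simp add: V_def Vh_def W_def)
  qed
  then have "optimality_equations S Q Qh rt V Vh"
    by (simp add: optimality_equations_def V_def) (simp add: Vh_def W_def)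
  then show ?thesis by blast
qed

section \<open>Verification argument of dynamic programming\<close>

context
  fixes V :: "nat \<Rightarrow> ('x, 'm) pi_state \<Rightarrow> ereal" and Vh :: "nat \<Rightarrow> ('x, 'y, 'm) phi_state \<Rightarrow> ereal"
  assumes eqs: "optimality_equations S Q Qh rt V Vh"
begin

lemma V_le:
  assumes "t \<in> {1..horizon S}"
  shows "V t (det_pi S Q Qh c l t) \<le> ereal (rt t (det_phi S Q Qh c l t)) + Vh t (det_phi S Q Qh c l t)"
proof -
  have "V t (det_pi S Q Qh c l t) = (INF c'. ereal (rt t (Q t c' (det_pi S Q Qh c l t)))
      + Vh t (Q t c' (det_pi S Q Qh c l t)))"
    using eqs assms by (simp add: optimality_equations_def det_pi_in_Laws)
  also have "\<dots> \<le> ereal (rt t (Q t (c t) (det_pi S Q Qh c l t))) + Vh t (Q t (c t) (det_pi S Q Qh c l t))"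
    by (rule INF_lower[where i = "c t"]) simp
  finally show ?thesis by (simp only: det_phi_def)
qed

lemma Vh_le:
  assumes "t \<in> {1..<horizon S}"
  shows "Vh t (det_phi S Q Qh c l t) \<le> V (Suc t) (det_pi S Q Qh c l (Suc t))"
proof -
  have "Vh t (det_phi S Q Qh c l t) = (MIN l'. V (t + 1) (Qh t l' (det_phi S Q Qh c l t)))"
    using eqs assms by (simp add: optimality_equations_def det_phi_in_Laws)
  also have "\<dots> \<le> V (Suc t) (Qh t (l t) (det_phi S Q Qh c l t))" by (intro Min_le) auto
  finally show ?thesis using assms by (simp add: det_pi_Suc)
qed

lemma Vh_horizon: "1 \<le> horizon S \<Longrightarrow> Vh (horizon S) (det_phi S Q Qh c l (horizon S)) = 0"
  using eqs by (simp add: optimality_equations_def det_phi_in_Laws)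

text \<open>Telescoping along an arbitrary trajectory. The remaining value stays on the right
  because it may be infinite and cannot be subtracted; only real partial sums are added to
  it.\<close>

lemma V1_le_partial_cost:
  assumes "1 \<le> n" "n \<le> horizon S"
  shows "V 1 (pi_init S) \<le> ereal (\<Sum>t = 1..n. rt t (det_phi S Q Qh c l t)) + Vh n (det_phi S Q Qh c l n)"
  using assms
proof (induction rule: dec_induct)
  case base
  then show ?case using V_le[of 1 c l] by simp
next
  case (step n)
  let ?r = "\<lambda>n. ereal (\<Sum>t = 1..n. rt t (det_phi S Q Qh c l t))"
  have "V 1 (pi_init S) \<le> ?r n + Vh n (det_phi S Q Qh c l n)" using step by simp
  also have "\<dots> \<le> ?r n + V (Suc n) (det_pi S Q Qh c l (Suc n))"
    using step by (intro add_left_mono Vh_le) simp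
  also have "\<dots> \<le> ?r n + (ereal (rt (Suc n) (det_phi S Q Qh c l (Suc n))) + Vh (Suc n) (det_phi S Q Qh c l (Suc n)))"
    using step by (intro add_left_mono V_le) simp
  also have "\<dots> = ?r (Suc n) + Vh (Suc n) (det_phi S Q Qh c l (Suc n))"
    by (simp add: add.assoc[symmetric])
  finally show ?case .
qed

text \<open>The same telescoping, with both one-step inequalities turned into equalities by
  \<open>determined_by\<close>.\<close>

lemma V1_eq_partial_cost:
  assumes "determined_by S Q Qh rt V Vh c l" "1 \<le> n" "n \<le> horizon S"
  shows "V 1 (pi_init S) = ereal (\<Sum>t = 1..n. rt t (det_phi S Q Qh c l t)) + Vh n (det_phi S Q Qh c l n)"
  using assms(2,3)
proof (induction rule: dec_induct)
  case base
  then have "1 \<in> {1..horizon S}" by simp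
  with assms(1) show ?case unfolding determined_by_def
    by (elim conjE) (drule bspec, assumption, simp add: det_phi_def)
next
  case (step n)
  let ?r = "\<lambda>n. ereal (\<Sum>t = 1..n. rt t (det_phi S Q Qh c l t))"
  have "V 1 (pi_init S) = ?r n + Vh n (det_phi S Q Qh c l n)" using step by simp
  also have "Vh n (det_phi S Q Qh c l n) = V (Suc n) (det_pi S Q Qh c l (Suc n))"
    using assms(1) step by (simp add: determined_by_def det_pi_Suc)
  also have "\<dots> = ereal (rt (Suc n) (det_phi S Q Qh c l (Suc n))) + Vh (Suc n) (det_phi S Q Qh c l (Suc n))"
    using assms(1) step by (simp add: determined_by_def det_phi_def)
  finally show ?case by (simp add: add.assoc[symmetric])
qed

lemma determined_by_imp_problem3_optimal:
  assumes "1 \<le> horizon S" and "determined_by S Q Qh rt V Vh c l"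
  shows "problem3_optimal S Q Qh rt c l"
  unfolding problem3_optimal_def
proof (intro allI)
  fix c' l'
  have "ereal (J3 S Q Qh rt c l) = V 1 (pi_init S)"
    using V1_eq_partial_cost[OF assms(2,1)] Vh_horizon[OF assms(1)] by (simp add: J3_def)
  also have "\<dots> \<le> ereal (J3 S Q Qh rt c' l')"
    using V1_le_partial_cost[OF assms(1)] Vh_horizon[OF assms(1)] by (simp add: J3_def)
  finally show "J3 S Q Qh rt c l \<le> J3 S Q Qh rt c' l'" by simp
qed

text \<open>Truncation of \<open>determined_by\<close> to the first \<open>n\<close> stages, which
  allows a design to be built forward in time.\<close>

definition attains_upto where
  "attains_upto n c l \<longleftrightarrow>
     (\<forall>t\<in>{1..horizon S}. t \<le> n \<longrightarrow>
        ereal (rt t (det_phi S Q Qh c l t)) + Vh t (det_phi S Q Qh c l t) = V t (det_pi S Q Qh c l t)) \<and>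
     (\<forall>t\<in>{1..<horizon S}. t \<le> n \<longrightarrow>
        V (Suc t) (Qh t (l t) (det_phi S Q Qh c l t)) = Vh t (det_phi S Q Qh c l t))"

lemma attains_upto_ex: "\<exists>c l. attains_upto n c l"
proof (induction n)
  case 0
  show ?case by (auto simp: attains_upto_def)
next
  case (Suc n)
  then obtain c l where cl: "attains_upto n c l" by blast
  show ?case
  proof (cases "Suc n \<le> horizon S")
    case False
    with cl have "attains_upto (Suc n) c l" by (auto simp: attains_upto_def le_Suc_eq)
    then show ?thesis by blast
  next
    case True
    let ?n = "Suc n"
    let ?\<pi> = "det_pi S Q Qh c l ?n"
    \<comment> \<open>The infimum is over infinitely many rules, but its values factor through the
      finitely many states reachable in one step.\<close>
    have "range (\<lambda>c'. ereal (rt ?n (Q ?n c' ?\<pi>)) + Vh ?n (Q ?n c' ?\<pi>)) =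
        (\<lambda>\<phi>. ereal (rt ?n \<phi>) + Vh ?n \<phi>) ` range (\<lambda>c'. Q ?n c' ?\<pi>)"
      by (simp add: image_image)
    with True have "finite (range (\<lambda>c'. ereal (rt ?n (Q ?n c' ?\<pi>)) + Vh ?n (Q ?n c' ?\<pi>)))"
      by (simp only: finite_imageI finite_range_Q_det_pi)
    from INF_attained_finite_range[OF this] obtain a where
      "ereal (rt ?n (Q ?n a ?\<pi>)) + Vh ?n (Q ?n a ?\<pi>) =
        (INF c'. ereal (rt ?n (Q ?n c' ?\<pi>)) + Vh ?n (Q ?n c' ?\<pi>))"
      by blast
    also have "\<dots> = V ?n ?\<pi>"
      using eqs True by (simp add: optimality_equations_def det_pi_in_Laws)
    finally have a: "ereal (rt ?n (Q ?n a ?\<pi>)) + Vh ?n (Q ?n a ?\<pi>) = V ?n ?\<pi>" .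
    let ?\<phi> = "Q ?n a ?\<pi>"
    have "Min (range (\<lambda>l'. V (Suc ?n) (Qh ?n l' ?\<phi>))) \<in> range (\<lambda>l'. V (Suc ?n) (Qh ?n l' ?\<phi>))"
      by (rule Min_in) auto
    then obtain b where b: "V (Suc ?n) (Qh ?n b ?\<phi>) = (MIN l'. V (Suc ?n) (Qh ?n l' ?\<phi>))"
      by (metis (no_types, lifting) imageE)
    \<comment> \<open>The horizon is excluded: no memory update follows the last stage.\<close>
    have b: "V (Suc ?n) (Qh ?n b ?\<phi>) = Vh ?n ?\<phi>" if "?n \<in> {1..<horizon S}"
      using eqs that b True by (simp add: optimality_equations_def det_pi_in_Laws Q_in_Laws)
    \<comment> \<open>Rules chosen at stage \<open>?n\<close> act only after the state \<pi> of that
      stage, so whatever was secured earlier survives the update.\<close>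
    have pi: "det_pi S Q Qh (c(?n := a)) (l(?n := b)) t = det_pi S Q Qh c l t" if "t \<le> ?n" for t
      using that by (intro det_pi_cong) simp
    then have phi: "det_phi S Q Qh (c(?n := a)) (l(?n := b)) t =
        (if t = ?n then ?\<phi> else det_phi S Q Qh c l t)" if "t \<le> ?n" for t
      using that by (simp add: det_phi_def)
    have "attains_upto ?n (c(?n := a)) (l(?n := b))"
      using cl a b by (auto simp: attains_upto_def pi phi le_Suc_eq)
    then show ?thesis by blast
  qed
qed

lemma determined_by_ex: "\<exists>c l. determined_by S Q Qh rt V Vh c l"
  using attains_upto_ex[of "horizon S"] by (simp add: attains_upto_def determined_by_def det_phi_def)

end

end

section \<open>The belief about the receiver's memory\<close>

text \<open>The encoder gets no feedback from the channel, so the filter is a pure prediction: a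
  push-forward without Bayesian correction.\<close>

definition belief_step :: "('x, 'z, 'y, 'm) comm_data \<Rightarrow> (nat \<Rightarrow> ('y, 'm) mem_update) \<Rightarrow>
    nat \<Rightarrow> 'm pmf \<Rightarrow> 'z \<Rightarrow> 'm pmf" where
  "belief_step S l t b z = bind_pmf b (\<lambda>m. map_pmf (\<lambda>y. l t (y, m)) (channel S t z))"

text \<open>Driven by the channel inputs alone, hence the same recursion for all encoders. The entry
  \<open>zs ! t\<close> is the input of stage \<open>t + 1\<close>.\<close>

primrec belief :: "('x, 'z, 'y, 'm) comm_data \<Rightarrow> (nat \<Rightarrow> ('y, 'm) mem_update) \<Rightarrow>
    nat \<Rightarrow> 'z list \<Rightarrow> 'm pmf" where
  "belief S l 0 zs = return_pmf (mem_init S)"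
| "belief S l (Suc t) zs = belief_step S l (Suc t) (belief S l t zs) (zs ! t)"

lemma belief_append: "t \<le> length zs \<Longrightarrow> belief S l t (zs @ zs') = belief S l t zs"
  by (induction t) (simp_all add: nth_append)

lemma belief_snoc:
  "length zs = t \<Longrightarrow> belief S l (Suc t) (zs @ [z]) = belief_step S l (Suc t) (belief S l t zs) z"
  by (simp add: belief_append nth_append)

lemma bind_traj_Suc:
  "bind_pmf (traj S e (Suc t)) F = bind_pmf (traj S e t) (\<lambda>h. bind_pmf (src_law S t (srcs h)) (\<lambda>x.
     bind_pmf (channel S (Suc t) (e (Suc t) (srcs h @ [x]))) (\<lambda>y. F (h @ [(x, e (Suc t) (srcs h @ [x]), y)]))))"
  by (simp add: traj_Suc bind_assoc_pmf bind_map_pmf)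

text \<open>
  This says that \<open>belief\<close> is the conditional law of the memory given the source and channel-input
  sequences, without mentioning conditional probabilities; the arbitrary \<open>F\<close> carries the induction.
\<close>

lemma resample_mem:
  "bind_pmf (traj S e t) (\<lambda>h. F (srcs h) (ins h) (mem S l t h)) =
   bind_pmf (traj S e t) (\<lambda>h. bind_pmf (belief S l t (ins h)) (F (srcs h) (ins h)))"
proof (induction t arbitrary: F)
  case 0
  show ?case by (simp add: bind_return_pmf)
next
  case (Suc t)
  let ?z = "\<lambda>xs x. e (Suc t) (xs @ [x])"
  have "bind_pmf (traj S e (Suc t)) (\<lambda>h. F (srcs h) (ins h) (mem S l (Suc t) h)) =
      bind_pmf (traj S e t) (\<lambda>h. bind_pmf (src_law S t (srcs h)) (\<lambda>x.
        bind_pmf (channel S (Suc t) (?z (srcs h) x)) (\<lambda>y.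
          F (srcs h @ [x]) (ins h @ [?z (srcs h) x]) (l (Suc t) (y, mem S l t h)))))"
    unfolding bind_traj_Suc
  proof (intro bind_pmf_cong)
    fix h x y assume "h \<in> set_pmf (traj S e t)"
    then have "length h = t" by (rule length_traj)
    then show "F (srcs (h @ [(x, ?z (srcs h) x, y)])) (ins (h @ [(x, ?z (srcs h) x, y)]))
        (mem S l (Suc t) (h @ [(x, ?z (srcs h) x, y)])) =
      F (srcs h @ [x]) (ins h @ [?z (srcs h) x]) (l (Suc t) (y, mem S l t h))"
      by (auto simp: mem_append)
  qed auto
  also have "\<dots> = bind_pmf (traj S e t) (\<lambda>h. bind_pmf (belief S l t (ins h)) (\<lambda>m.
      bind_pmf (src_law S t (srcs h)) (\<lambda>x.
        bind_pmf (channel S (Suc t) (?z (srcs h) x)) (\<lambda>y.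
          F (srcs h @ [x]) (ins h @ [?z (srcs h) x]) (l (Suc t) (y, m))))))"
    \<comment> \<open>The whole of stage \<open>t + 1\<close> serves as the continuation
      \<open>F\<close>; it sees the past only through the source sequence, the inputs and the
      memory.\<close>
    by (rule Suc.IH)
  also have "\<dots> = bind_pmf (traj S e t) (\<lambda>h. bind_pmf (src_law S t (srcs h)) (\<lambda>x.
      bind_pmf (channel S (Suc t) (?z (srcs h) x)) (\<lambda>_.
        bind_pmf (belief_step S l (Suc t) (belief S l t (ins h)) (?z (srcs h) x))
          (F (srcs h @ [x]) (ins h @ [?z (srcs h) x])))))"
    \<comment> \<open>Given the past, memory and next source symbol are drawn independently and may
      be swapped; the channel draw then moves into \<open>belief_step\<close>. The vacuous outer
      channel draw restores the shape of \<open>bind_traj_Suc\<close>.\<close>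
    by (subst bind_commute_pmf) (simp add: belief_step_def bind_assoc_pmf bind_map_pmf)
  also have "\<dots> = bind_pmf (traj S e (Suc t))
      (\<lambda>h. bind_pmf (belief S l (Suc t) (ins h)) (F (srcs h) (ins h)))"
    unfolding bind_traj_Suc
    by (intro bind_pmf_cong) (auto simp: belief_snoc length_traj simp del: belief.simps)
  finally show ?case .
qed

text \<open>Uniqueness of a disintegration at an atom of \<open>k\<close>, the bridge from a
  resampling identity to \<open>cond_pmf\<close>. On the pair space the conditioning event is the
  cylinder \<open>s\<close>, whose mass factors out of the joint law.\<close>

lemma map_cond_pmf_eqI:
  fixes k :: "'a \<Rightarrow> 'k" and f :: "'a \<Rightarrow> 'b"
  assumes joint: "map_pmf (\<lambda>x. (k x, f x)) p = bind_pmf p (\<lambda>x. map_pmf (Pair (k x)) (\<beta> (k x)))"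
    and "x0 \<in> set_pmf p"
  shows "map_pmf f (cond_pmf p {x. k x = k x0}) = \<beta> (k x0)"
proof -
  define r where "r = map_pmf (\<lambda>x. (k x, f x)) p"
  define s where "s = {k x0} \<times> (UNIV :: 'b set)"
  have vim: "(\<lambda>x. (k x, f x)) -` s = {x. k x = k x0}" by (auto simp: s_def)
  have ne: "set_pmf p \<inter> (\<lambda>x. (k x, f x)) -` s \<noteq> {}" using assms(2) by (auto simp: s_def)
  have ne': "set_pmf r \<inter> s \<noteq> {}" using assms(2) by (auto simp: r_def s_def)
  have pos: "measure p {x. k x = k x0} > 0"
    by (rule measure_pmf_posI[OF assms(2)]) simp
  have "pmf (cond_pmf r s) (a, m) = pmf (map_pmf (Pair (k x0)) (\<beta> (k x0))) (a, m)" for a m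
  proof (cases "a = k x0")
    case True
    have "pmf r (k x0, m) = (\<integral>x. pmf (map_pmf (Pair (k x)) (\<beta> (k x))) (k x0, m) \<partial>p)"
      unfolding r_def joint pmf_bind ..
    \<comment> \<open>The kernel at \<open>x\<close> charges only pairs with first entry
      \<open>k x\<close>, so only the fibre of \<open>k x0\<close> contributes.\<close>
    also have "\<dots> = (\<integral>x. indicator {x. k x = k x0} x * pmf (\<beta> (k x0)) m \<partial>p)"
    proof (rule Bochner_Integration.integral_cong)
      fix x
      show "pmf (map_pmf (Pair (k x)) (\<beta> (k x))) (k x0, m) =
          indicator {x. k x = k x0} x * pmf (\<beta> (k x0)) m"
        by (cases "k x = k x0")
          (auto simp: pmf_map_inj' inj_on_def pmf_eq_0_set_pmf)
    qed simp
    also have "\<dots> = measure p {x. k x = k x0} * pmf (\<beta> (k x0)) m" by simp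
    finally have "pmf r (k x0, m) = measure p {x. k x = k x0} * pmf (\<beta> (k x0)) m" .
    moreover have "measure r s = measure p {x. k x = k x0}" by (simp add: r_def vim)
    moreover have "pmf (map_pmf (Pair (k x0)) (\<beta> (k x0))) (k x0, m) = pmf (\<beta> (k x0)) m"
      by (rule pmf_map_inj') (simp add: inj_on_def)
    ultimately show ?thesis using True pos by (simp add: pmf_cond[OF ne']) (simp add: s_def)
  next
    case False
    then show ?thesis by (simp add: pmf_cond[OF ne']) (auto simp: s_def pmf_eq_0_set_pmf)
  qed
  then have "cond_pmf r s = map_pmf (Pair (k x0)) (\<beta> (k x0))" by (intro pmf_eqI) auto
  then have "map_pmf (\<lambda>x. (k x, f x)) (cond_pmf p {x. k x = k x0}) = map_pmf (Pair (k x0)) (\<beta> (k x0))"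
    using cond_map_pmf[OF ne] by (simp add: r_def vim)
  then have "map_pmf snd (map_pmf (\<lambda>x. (k x, f x)) (cond_pmf p {x. k x = k x0})) =
      map_pmf snd (map_pmf (Pair (k x0)) (\<beta> (k x0)))" by simp
  then show ?thesis by (simp add: map_pmf_comp)
qed

text \<open>Takes \<open>F\<close> in \<open>resample_mem\<close> to record all its arguments, then
  disintegrates. Histories off the support are excluded since \<open>cond_pmf\<close> may be
  unspecified there.\<close>

lemma mem_belief_eq_belief:
  assumes "h \<in> set_pmf (traj S e t)"
  shows "mem_belief S e l t (srcs h) (ins h) = belief S l t (ins h)"
proof -
  let ?k = "\<lambda>h. (srcs h, ins h)"
  have "map_pmf (\<lambda>h. (?k h, mem S l t h)) (traj S e t) =
      bind_pmf (traj S e t) (\<lambda>h. map_pmf (Pair (?k h)) (belief S l t (ins h)))"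
    using resample_mem[of S e t "\<lambda>xs zs m. return_pmf ((xs, zs), m)" l] by (simp add: map_pmf_def)
  from map_cond_pmf_eqI[where \<beta> = "\<lambda>(xs, zs). belief S l t zs" and k = ?k, simplified, OF this assms]
  show ?thesis by (simp add: mem_belief_def given_def)
qed

lemma struct_enc_on_traj:
  assumes "h \<in> set_pmf (traj S (struct_enc S c l) t)"
  shows "struct_enc S c l (Suc t) (srcs h @ [x]) = c (Suc t) (x, belief S l t (ins h))"
  using assms by (simp add: struct_enc_snoc length_traj ins_traj[symmetric] mem_belief_eq_belief)

section \<open>Optimality of structured encoders\<close>

text \<open>Output and old memory enter as independent draws given the input. At the last stage
  \<open>w\<close> is zero, so the transition beyond the horizon contributes nothing.\<close>

definition bellman :: "('x, 'z, 'y, 'm) comm_data \<Rightarrow> ('x, 'y, 'm) decoder \<Rightarrow>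
    (nat \<Rightarrow> ('y, 'm) mem_update) \<Rightarrow> nat \<Rightarrow> ('x \<Rightarrow> 'm pmf \<Rightarrow> real) \<Rightarrow> 'x \<Rightarrow> 'm pmf \<Rightarrow> 'z \<Rightarrow> real" where
  "bellman S g l t w x b z =
     measure_pmf.expectation (channel S t z) (\<lambda>y.
       measure_pmf.expectation b (\<lambda>m. distortion S t x (g t (y, m)))) +
     measure_pmf.expectation (src_trans S t x) (\<lambda>x'. w x' (belief_step S l t b z))"

text \<open>The first numerical argument of \<open>cost_to_go\<close> is the number of remaining stages.\<close>

primrec cost_to_go :: "('x, 'z::finite, 'y, 'm) comm_data \<Rightarrow> ('x, 'y, 'm) decoder \<Rightarrow>
    (nat \<Rightarrow> ('y, 'm) mem_update) \<Rightarrow> nat \<Rightarrow> 'x \<Rightarrow> 'm pmf \<Rightarrow> real" where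
  "cost_to_go S g l 0 = (\<lambda>x b. 0)"
| "cost_to_go S g l (Suc k) =
     (\<lambda>x b. MIN z. bellman S g l (horizon S - k) (cost_to_go S g l k) x b z)"

context
  fixes S :: "('x::finite, 'z::finite, 'y::finite, 'm::finite) comm_data"
    and g :: "('x, 'y, 'm) decoder"
    and l :: "nat \<Rightarrow> ('y, 'm) mem_update"
begin

text \<open>Evaluated between stages: \<open>X(t+1)\<close> has been drawn but not yet encoded. This
  is the potential that telescopes against the stage costs.\<close>

definition expected_to_go :: "('x, 'z) encoder \<Rightarrow> nat \<Rightarrow> real" where
  "expected_to_go e t = measure_pmf.expectation (traj S e t) (\<lambda>h.
     measure_pmf.expectation (src_law S t (srcs h)) (\<lambda>x.
       cost_to_go S g l (horizon S - t) x (belief S l t (ins h))))"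

lemma expected_to_go_0:
  "expected_to_go e 0 = measure_pmf.expectation (src_init S) (\<lambda>x.
     cost_to_go S g l (horizon S) x (return_pmf (mem_init S)))"
  by (simp add: expected_to_go_def src_law_def)

lemma expected_to_go_horizon: "expected_to_go e (horizon S) = 0"
  by (simp add: expected_to_go_def)

lemma stage_cost_Suc:
  "stage_cost S e g l (Suc t) = measure_pmf.expectation (traj S e t) (\<lambda>h.
     measure_pmf.expectation (src_law S t (srcs h)) (\<lambda>x.
       measure_pmf.expectation (channel S (Suc t) (e (Suc t) (srcs h @ [x]))) (\<lambda>y.
         measure_pmf.expectation (belief S l t (ins h)) (\<lambda>m.
           distortion S (Suc t) x (g (Suc t) (y, m))))))"
proof -
  let ?z = "\<lambda>xs x. e (Suc t) (xs @ [x])"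
  let ?d = "\<lambda>(x, ym). distortion S (Suc t) x (g (Suc t) ym)"
  let ?obs = "\<lambda>h. (src_at (Suc t) h, out_at (Suc t) h, mem S l t h)"
  have "map_pmf ?obs (traj S e (Suc t)) = bind_pmf (traj S e (Suc t)) (\<lambda>h. return_pmf (?obs h))"
    by (simp add: map_pmf_def)
  also have "\<dots> = bind_pmf (traj S e t) (\<lambda>h. bind_pmf (src_law S t (srcs h)) (\<lambda>x.
      bind_pmf (channel S (Suc t) (?z (srcs h) x)) (\<lambda>y. return_pmf (x, y, mem S l t h))))"
    unfolding bind_traj_Suc
    by (intro bind_pmf_cong) (auto simp: mem_append dest!: length_traj)
  also have "\<dots> = bind_pmf (traj S e t) (\<lambda>h. bind_pmf (belief S l t (ins h)) (\<lambda>m.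
      bind_pmf (src_law S t (srcs h)) (\<lambda>x. bind_pmf (channel S (Suc t) (?z (srcs h) x)) (\<lambda>y.
        return_pmf (x, y, m)))))"
    \<comment> \<open>The true memory is replaced by a fresh draw from the belief; \<open>F\<close>
      contains the source and channel draws, which do not look at the memory.\<close>
    by (rule resample_mem[where F = "\<lambda>xs zs m. bind_pmf (src_law S t xs) (\<lambda>x.
      bind_pmf (channel S (Suc t) (?z xs x)) (\<lambda>y. return_pmf (x, y, m)))"])
  also have "\<dots> = bind_pmf (traj S e t) (\<lambda>h. bind_pmf (src_law S t (srcs h)) (\<lambda>x.
      bind_pmf (channel S (Suc t) (?z (srcs h) x)) (\<lambda>y. bind_pmf (belief S l t (ins h)) (\<lambda>m.
        return_pmf (x, y, m)))))"
    by (subst bind_commute_pmf, subst bind_commute_pmf) (rule refl)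
  finally have law: "map_pmf ?obs (traj S e (Suc t)) = \<dots>" .
  have "stage_cost S e g l (Suc t) = measure_pmf.expectation (map_pmf ?obs (traj S e (Suc t))) ?d"
    by (simp add: stage_cost_def)
  also have "\<dots> = measure_pmf.expectation (traj S e t) (\<lambda>h.
     measure_pmf.expectation (src_law S t (srcs h)) (\<lambda>x.
       measure_pmf.expectation (channel S (Suc t) (?z (srcs h) x)) (\<lambda>y.
         measure_pmf.expectation (belief S l t (ins h)) (\<lambda>m. ?d (x, y, m)))))"
    unfolding law by (simp add: expectation_bind_finite)
  finally show ?thesis by simp
qed

lemma expected_to_go_Suc:
  "expected_to_go e (Suc t) = measure_pmf.expectation (traj S e t) (\<lambda>h.
     measure_pmf.expectation (src_law S t (srcs h)) (\<lambda>x.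
       measure_pmf.expectation (src_trans S (Suc t) x) (\<lambda>x'.
         cost_to_go S g l (horizon S - Suc t) x'
           (belief_step S l (Suc t) (belief S l t (ins h)) (e (Suc t) (srcs h @ [x]))))))"
proof -
  have "expected_to_go e (Suc t) = measure_pmf.expectation (traj S e t) (\<lambda>h.
     measure_pmf.expectation (src_law S t (srcs h)) (\<lambda>x.
       measure_pmf.expectation (channel S (Suc t) (e (Suc t) (srcs h @ [x]))) (\<lambda>y.
         measure_pmf.expectation (src_law S (Suc t) (srcs h @ [x])) (\<lambda>x'.
           cost_to_go S g l (horizon S - Suc t) x'
             (belief S l (Suc t) (ins h @ [e (Suc t) (srcs h @ [x])]))))))"
    unfolding expected_to_go_def traj_Suc by (simp add: expectation_bind_finite del: belief.simps)
  \<comment> \<open>Neither the next belief nor the next source law depends on \<open>y\<close>, so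
    the channel expectation drops out.\<close>
  also have "\<dots> = measure_pmf.expectation (traj S e t) (\<lambda>h.
     measure_pmf.expectation (src_law S t (srcs h)) (\<lambda>x.
       measure_pmf.expectation (src_trans S (Suc t) x) (\<lambda>x'.
         cost_to_go S g l (horizon S - Suc t) x'
           (belief_step S l (Suc t) (belief S l t (ins h)) (e (Suc t) (srcs h @ [x]))))))"
    by (intro expectation_cong_pmf)
      (simp add: length_traj belief_snoc src_law_def nth_append del: belief.simps)
  finally show ?thesis .
qed

lemma stage_cost_plus_expected_to_go:
  "stage_cost S e g l (Suc t) + expected_to_go e (Suc t) =
   measure_pmf.expectation (traj S e t) (\<lambda>h. measure_pmf.expectation (src_law S t (srcs h)) (\<lambda>x.
     bellman S g l (Suc t) (cost_to_go S g l (horizon S - Suc t)) x (belief S l t (ins h))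
       (e (Suc t) (srcs h @ [x]))))"
  unfolding stage_cost_Suc expected_to_go_Suc bellman_def
  by (simp add: integrable_measure_pmf_finite)

lemma cost_to_go_eq_Min:
  assumes "t < horizon S"
  shows "cost_to_go S g l (horizon S - t) x b =
    (MIN z. bellman S g l (Suc t) (cost_to_go S g l (horizon S - Suc t)) x b z)"
proof -
  have "horizon S - t = Suc (horizon S - Suc t)" "horizon S - (horizon S - Suc t) = Suc t"
    using assms by simp_all
  then show ?thesis by simp
qed

text \<open>However the encoder uses the full history, its input is one of the candidates in the
  pointwise minimum over \<open>z\<close>.\<close>

lemma expected_to_go_le:
  assumes "t < horizon S"
  shows "expected_to_go e t \<le> stage_cost S e g l (Suc t) + expected_to_go e (Suc t)"
  unfolding stage_cost_plus_expected_to_go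
  unfolding expected_to_go_def cost_to_go_eq_Min[OF assms]
  by (intro expectation_mono_finite) auto

lemma expected_to_go_0_le_J: "expected_to_go e 0 \<le> J S e g l"
proof -
  have "expected_to_go e 0 \<le> (\<Sum>t = 1..n. stage_cost S e g l t) + expected_to_go e n"
    if "n \<le> horizon S" for n
    using that
  proof (induction n)
    case (Suc n)
    then show ?case using expected_to_go_le[of n e] by simp
  qed simp
  from this[of "horizon S"] show ?thesis by (simp add: expected_to_go_horizon J_eq_sum_stage_cost)
qed

lemma ex_struct_enc_le: "\<exists>c. \<forall>e. J S (struct_enc S c l) g l \<le> J S e g l"
proof -
  let ?B = "\<lambda>t x b z. bellman S g l t (cost_to_go S g l (horizon S - t)) x b z"
  \<comment> \<open>The minimizing input depends only on stage, source symbol and belief, which is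
    exactly what a structured rule may read.\<close>
  define c where "c t = (\<lambda>(x, b). SOME z. ?B t x b z = (MIN z. ?B t x b z))" for t
  have c: "?B t x b (c t (x, b)) = (MIN z. ?B t x b z)" for t x b
  proof -
    have "(MIN z. ?B t x b z) \<in> range (?B t x b)" by (rule Min_in) auto
    then have "\<exists>z. ?B t x b z = (MIN z. ?B t x b z)" by (metis (no_types, lifting) imageE)
    from someI_ex[OF this] show ?thesis by (simp add: c_def)
  qed
  let ?e = "struct_enc S c l"
  have step: "expected_to_go ?e t = stage_cost S ?e g l (Suc t) + expected_to_go ?e (Suc t)"
    if "t < horizon S" for t
    unfolding stage_cost_plus_expected_to_go
    unfolding expected_to_go_def cost_to_go_eq_Min[OF that]
    by (intro expectation_cong_pmf) (simp add: struct_enc_on_traj c)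
  have "expected_to_go ?e 0 = (\<Sum>t = 1..n. stage_cost S ?e g l t) + expected_to_go ?e n"
    if "n \<le> horizon S" for n
    using that by (induction n) (simp_all add: step)
  from this[of "horizon S"] have "J S ?e g l = expected_to_go ?e 0"
    by (simp add: expected_to_go_horizon J_eq_sum_stage_cost)
  \<comment> \<open>Before the first stage no rule has acted, so all encoders share this
    value.\<close>
  also have "\<dots> = expected_to_go e 0" for e by (simp add: expected_to_go_0)
  finally show ?thesis using expected_to_go_0_le_J by auto
qed

section \<open>Optimal decoding\<close>

text \<open>The stage cost is a sum of conditional risks weighted by the probabilities of the
  observations \<open>(y, m)\<close>, so it can be minimized separately for each
  observation.\<close>

lemma stage_cost_opt_decoder_le:
  "stage_cost S (struct_enc S c l) (opt_decoder S c l) l t \<le> stage_cost S (struct_enc S c l) g l t"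
proof -
  define p where "p = traj S (struct_enc S c l) t"
  define obs where "obs h = (out_at t h, mem S l (t - 1) h)" for h :: "('x, 'z, 'y) history"
  define risk where "risk ym xh = (\<Sum>x\<in>UNIV. distortion S t x xh *
     cond_prob (measure_pmf p) (\<lambda>h. src_at t h = x) (\<lambda>h. obs h = ym))" for ym xh
  have cost: "stage_cost S (struct_enc S c l) g' l t =
      (\<Sum>ym\<in>UNIV. measure p {h. obs h = ym} * risk ym (g' t ym))" for g'
  proof -
    have joint: "pmf (map_pmf (\<lambda>h. (obs h, src_at t h)) p) (ym, x) = measure p {h. obs h = ym} *
        cond_prob (measure_pmf p) (\<lambda>h. src_at t h = x) (\<lambda>h. obs h = ym)" for ym x
    proof -
      have "pmf (map_pmf (\<lambda>h. (obs h, src_at t h)) p) (ym, x) = measure p {h. src_at t h = x \<and> obs h = ym}"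
        unfolding pmf_map by (rule arg_cong[where f = "measure p"]) auto
      moreover have "measure p {h. src_at t h = x \<and> obs h = ym} \<le> measure p {h. obs h = ym}"
        by (rule measure_pmf.finite_measure_mono) auto
      ultimately show ?thesis
        \<comment> \<open>For a null observation the joint probability vanishes as well, so the
          value of \<open>cond_prob\<close> there is immaterial.\<close>
        by (cases "measure p {h. obs h = ym} = 0")
          (simp_all add: cond_prob_def measure_le_0_iff)
    qed
    have "stage_cost S (struct_enc S c l) g' l t =
        measure_pmf.expectation (map_pmf (\<lambda>h. (obs h, src_at t h)) p)
          (\<lambda>(ym, x). distortion S t x (g' t ym))"
      by (simp add: stage_cost_def p_def obs_def)
    also have "\<dots> = (\<Sum>(ym, x)\<in>UNIV \<times> UNIV. distortion S t x (g' t ym) *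
        pmf (map_pmf (\<lambda>h. (obs h, src_at t h)) p) (ym, x))"
      by (subst integral_measure_pmf_real[of "UNIV \<times> UNIV"]) (auto intro!: sum.cong)
    also have "\<dots> = (\<Sum>ym\<in>UNIV. \<Sum>x\<in>UNIV. distortion S t x (g' t ym) *
        pmf (map_pmf (\<lambda>h. (obs h, src_at t h)) p) (ym, x))"
      by (simp only: sum.cartesian_product)
    also have "\<dots> = (\<Sum>ym\<in>UNIV. measure p {h. obs h = ym} * risk ym (g' t ym))"
      by (simp only: joint risk_def sum_distrib_left mult.left_commute)
    finally show ?thesis .
  qed
  have "risk ym (opt_decoder S c l t ym) \<le> risk ym xh" for ym xh
  proof -
    obtain y m where ym: "ym = (y, m)" by (cases ym)
    have dec: "opt_decoder S c l t ym = arg_min (risk ym) (\<lambda>_. True)"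
      by (simp add: opt_decoder_def ym risk_def[abs_def] p_def obs_def)
    \<comment> \<open>\<open>arg_min\<close> is a choice operator; finiteness of the source alphabet
      supplies the minimizer that makes it meaningful.\<close>
    obtain k where "is_arg_min (risk ym) (\<lambda>x. x \<in> UNIV) k"
      using ex_is_arg_min_if_finite[of "UNIV :: 'x set" "risk ym"] by auto
    then have "\<exists>k. is_arg_min (risk ym) (\<lambda>_. True) k" by auto
    then have "is_arg_min (risk ym) (\<lambda>_. True) (arg_min (risk ym) (\<lambda>_. True))"
      unfolding arg_min_def by (rule someI_ex)
    then show ?thesis by (simp add: dec is_arg_min_linorder)
  qed
  then show ?thesis unfolding cost by (intro sum_mono mult_left_mono) auto
qed

lemma J2_le_J: "J2 S c l \<le> J S (struct_enc S c l) g l"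
  unfolding J2_def J_eq_sum_stage_cost by (intro sum_mono stage_cost_opt_decoder_le)

end

section \<open>From structured designs to arbitrary ones\<close>

lemma problem2_optimal_imp_problem1_optimal:
  fixes S :: "('x::finite, 'z::finite, 'y::finite, 'm::finite) comm_data"
  assumes "problem2_optimal S c l"
  shows "problem1_optimal S (struct_enc S c l) (opt_decoder S c l) l"
  unfolding problem1_optimal_def
proof (intro allI)
  fix e' g' l'
  \<comment> \<open>The structured competitor is tailored to the given \<open>g'\<close> and
    \<open>l'\<close>; only afterwards is \<open>g'\<close> replaced by its optimal decoder.\<close>
  obtain c' where c': "J S (struct_enc S c' l') g' l' \<le> J S e' g' l'"
    using ex_struct_enc_le by blast
  have "J S (struct_enc S c l) (opt_decoder S c l) l = J2 S c l" by (simp add: J2_def)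
  also have "\<dots> \<le> J2 S c' l'" using assms by (simp add: problem2_optimal_def)
  also have "\<dots> \<le> J S (struct_enc S c' l') g' l'" by (rule J2_le_J)
  also note c'
  finally show "J S (struct_enc S c l) (opt_decoder S c l) l \<le> J S e' g' l'" .
qed

theorem theorem4:
  fixes S :: "('x::finite, 'z::finite, 'y::finite, 'm::finite) comm_data"
    and Q :: "nat \<Rightarrow> ('x, 'z, 'm) senc \<Rightarrow> ('x, 'm) pi_state \<Rightarrow> ('x, 'y, 'm) phi_state"
    and Qh :: "nat \<Rightarrow> ('y, 'm) mem_update \<Rightarrow> ('x, 'y, 'm) phi_state \<Rightarrow> ('x, 'm) pi_state"
    and rt :: "nat \<Rightarrow> ('x, 'y, 'm) phi_state \<Rightarrow> real"
  assumes "comm_system S"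
    and "info_state_maps S Q Qh rt"
  shows "(\<exists>V Vh. optimality_equations S Q Qh rt V Vh) \<and>
    (\<forall>V Vh. optimality_equations S Q Qh rt V Vh \<longrightarrow>
      (\<exists>c l. determined_by S Q Qh rt V Vh c l) \<and>
      (\<forall>c l. determined_by S Q Qh rt V Vh c l \<longrightarrow>
         problem3_optimal S Q Qh rt c l \<and>
         problem2_optimal S c l \<and>
         problem1_optimal S (struct_enc S c l) (opt_decoder S c l) l))"
proof (intro conjI allI impI)
  show "\<exists>V Vh. optimality_equations S Q Qh rt V Vh"
    by (rule optimality_equations_solvable[OF assms(2)])
  fix V Vh assume eqs: "optimality_equations S Q Qh rt V Vh"
  show "\<exists>c l. determined_by S Q Qh rt V Vh c l"
    by (rule determined_by_ex[OF assms(2) eqs])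
  fix c l assume "determined_by S Q Qh rt V Vh c l"
  then show p3: "problem3_optimal S Q Qh rt c l"
    using determined_by_imp_problem3_optimal[OF assms(2) eqs] assms(1) by (simp add: comm_system_def)
  then show p2: "problem2_optimal S c l"
    by (simp add: problem3_optimal_def problem2_optimal_def J2_eq_J3[OF assms(2)])
  then show "problem1_optimal S (struct_enc S c l) (opt_decoder S c l) l"
    by (rule problem2_optimal_imp_problem1_optimal)
qed

end
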